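(* Let $v_1,\dots,v_m$ be finitely many unit vectors in $\mathbb{R}^n$ and let $\alpha=(u_1,u_2,\dots)$ be any sequence with each $u_i\in\{v_1,\dots,v_m\}$. Then for every nonempty compact convex set $K\subseteq\mathbb{R}^n$, the limit $L=\mathrm{s}_\alpha K=\lim_{i\to\infty}\mathrm{s}_{u_i}\cdots\mathrm{s}_{u_1}K$ exists in the Hausdorff metric, and $L$ is symmetric under reflection across the hyperplane $v_j^\perp$ for each $v_j$ that occurs infinitely often in $\alpha$.
   Context: For a nonempty compact convex $K\subseteq\mathbb{R}^n$ and a unit vector $u$, the Steiner symmetrization $\mathrm{s}_uK$ is defined as follows: for each point $x$ of the orthogonal projection $\pi_uK$ of $K$ onto $u^\perp$, let $\ell_x(K)$ be the length of the segment $K\cap(x+\mathbb{R}u)$; then $\mathrm{s}_uK=\{x+tu:\ x\in\pi_uK,\ |t|\le \tfrac12\ell_x(K)\}$. *)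

theory Defs
  imports "HOL-Analysis.Analysis"
begin

(* Hausdorff distance between (nonempty bounded) sets *)
definition hausdist :: "'a::metric_space set \<Rightarrow> 'a set \<Rightarrow> real" where
  "hausdist A B = max (SUP a\<in>A. infdist a B) (SUP b\<in>B. infdist b A)"

(* orthogonal projection onto u^\<perp> (u a unit vector) *)
definition proj_perp :: "'a::euclidean_space \<Rightarrow> 'a \<Rightarrow> 'a" where
  "proj_perp u y = y - (y \<bullet> u) *\<^sub>R u"

definition chord_len :: "'a::euclidean_space \<Rightarrow> 'a set \<Rightarrow> 'a \<Rightarrow> real" where
  "chord_len u K x = Sup {t. x + t *\<^sub>R u \<in> K} - Inf {t. x + t *\<^sub>R u \<in> K}"

definition steiner :: "'a::euclidean_space \<Rightarrow> 'a set \<Rightarrow> 'a set" where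
  "steiner u K = {x + t *\<^sub>R u | x t. x \<in> proj_perp u ` K \<and> \<bar>t\<bar> \<le> chord_len u K x / 2}"

primrec steiner_iter :: "(nat \<Rightarrow> 'a::euclidean_space) \<Rightarrow> 'a set \<Rightarrow> nat \<Rightarrow> 'a set" where
  "steiner_iter u K 0 = K"
| "steiner_iter u K (Suc i) = steiner (u i) (steiner_iter u K i)"

definition reflect :: "'a::euclidean_space \<Rightarrow> 'a \<Rightarrow> 'a" where
  "reflect v x = x - (2 * (x \<bullet> v)) *\<^sub>R v"

end

theory Submission
  imports Defs "HOL-Complex_Analysis.Great_Picard"
begin

text \<open>
  Let \<open>h\<^sub>i\<close> be the support function of the \<open>i\<close>-th iterate on the unit ball.  Since
  \<open>s\<^sub>u K\<close> lies in the Minkowski average of \<open>K\<close> and its reflection, \<open>h\<close> at step \<open>i + 1\<close> is at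
  most the average of \<open>h\<^sub>i\<close> and its reflection, so the integral of \<open>exp h\<^sub>i\<close> decreases;
  the drop vanishes in the limit, and strict convexity of the exponential makes every
  subsequential limit invariant under the recurring reflections.  An invariant limit \<open>g\<close> is a barrier: once
  \<open>h\<^sub>i \<le> g + e\<close>, this persists, and together with the limit of the integrals it
  forces the whole sequence to converge to \<open>g\<close>.  Working with support functions rather than
  volumes avoids the discontinuity of Steiner symmetrization at sets with empty interior.
\<close>

section \<open>Reflections and orthogonal invariance of Lebesgue measure\<close>

text \<open>With \<open>B\<close> the unit ball, whose indicator is invariant under
  \<open>f\<close>, the double integral of \<open>indicator A (f x) * indicator B (y + f x)\<close>
  is evaluated in both orders. One order gives the measure of the preimage of \<open>A\<close> times
  that of \<open>B\<close>, the other the measure of \<open>A\<close> times that of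
  \<open>B\<close>; the common factor is positive and finite and cancels.\<close>

lemma lborel_distr_orthogonal_transformation:
  fixes f :: "'a::euclidean_space \<Rightarrow> 'a"
  assumes f: "orthogonal_transformation f"
  shows "distr lborel borel f = lborel"
proof (rule measure_eqI)
  have lin: "linear f" and nf: "norm (f x) = norm x" for x
    using f by (auto simp: orthogonal_transformation)
  have [measurable]: "f \<in> borel_measurable borel"
    using lin by (intro borel_measurable_continuous_onI linear_continuous_on linear_conv_bounded_linear[THEN iffD1])
  have shift: "(\<integral>\<^sup>+ y. g (y + a) \<partial>lborel) = (\<integral>\<^sup>+ y. g y \<partial>lborel)"
    if [measurable]: "g \<in> borel_measurable borel" for g :: "'a \<Rightarrow> ennreal" and a
    by (subst (2) lborel_distr_plus[symmetric, where c = a])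
       (simp add: nn_integral_distr add.commute)
  have flip: "(\<integral>\<^sup>+ y. g (a - y) \<partial>lborel) = (\<integral>\<^sup>+ y. g y \<partial>lborel)"
    if [measurable]: "g \<in> borel_measurable borel" for g :: "'a \<Rightarrow> ennreal" and a
  proof -
    have *: "(lborel :: 'a measure) = distr lborel borel (\<lambda>y. a - y)"
      using lborel_affine[of "-1" a] by (simp add: density_1)
    show ?thesis
      by (subst (2) *) (simp add: nn_integral_distr)
  qed
  fix A assume "A \<in> sets (distr lborel borel f)"
  then have [measurable]: "A \<in> sets borel" by simp
  define B :: "'a set" where "B = ball 0 1"
  have [measurable]: "B \<in> sets borel" by (simp add: B_def)
  have eB: "emeasure lborel B \<noteq> 0" "emeasure lborel B \<noteq> \<infinity>"
    using emeasure_lborel_ball_finite[of "0::'a" 1]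
    by (auto simp: B_def emeasure_ball ennreal_eq_0_iff not_le unit_ball_vol_pos)
  have indB: "indicator B (f x) = (indicator B x :: ennreal)" for x
    by (simp add: B_def indicator_def nf)
  have "(\<integral>\<^sup>+x. indicator A (f x) \<partial>lborel) * emeasure lborel B
        = (\<integral>\<^sup>+x. indicator A (f x) * (\<integral>\<^sup>+y. indicator B y \<partial>lborel) \<partial>lborel)"
    by (simp add: nn_integral_multc)
  also have "\<dots> = (\<integral>\<^sup>+x. indicator A (f x) * (\<integral>\<^sup>+y. indicator B (y + f x) \<partial>lborel) \<partial>lborel)"
    by (subst shift) auto
  also have "\<dots> = (\<integral>\<^sup>+x. (\<integral>\<^sup>+y. indicator A (f x) * indicator B (y + f x) \<partial>lborel) \<partial>lborel)"
    by (subst nn_integral_cmult) auto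
  also have "\<dots> = (\<integral>\<^sup>+y. (\<integral>\<^sup>+x. indicator A (f x) * indicator B (y + f x) \<partial>lborel) \<partial>lborel)"
    by (rule lborel_pair.Fubini') measurable
  \<comment> \<open>Translating \<open>x\<close> by a preimage \<open>w\<close> of \<open>y\<close>
    moves \<open>y\<close> from the argument of \<open>B\<close> to that of \<open>A\<close>, so the
    factor with \<open>B\<close> no longer depends on \<open>y\<close>.\<close>
  also have "\<dots> = (\<integral>\<^sup>+y. (\<integral>\<^sup>+x. indicator A (f x - y) * indicator B (f x) \<partial>lborel) \<partial>lborel)"
  proof (rule nn_integral_cong)
    fix y
    obtain w where w: "f w = y"
      using orthogonal_transformation_surj[OF f] by (metis surjD)
    show "(\<integral>\<^sup>+x. indicator A (f x) * indicator B (y + f x) \<partial>lborel)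
        = (\<integral>\<^sup>+x. indicator A (f x - y) * indicator B (f x) \<partial>lborel)"
      using shift[of "\<lambda>x. indicator A (f x - y) * indicator B (f x)" w]
      by (simp add: linear_add[OF lin] w add.commute)
  qed
  also have "\<dots> = (\<integral>\<^sup>+x. (\<integral>\<^sup>+y. indicator A (f x - y) * indicator B (f x) \<partial>lborel) \<partial>lborel)"
    by (rule lborel_pair.Fubini') measurable
  also have "\<dots> = (\<integral>\<^sup>+x. (\<integral>\<^sup>+y. indicator A (f x - y) \<partial>lborel) * indicator B (f x) \<partial>lborel)"
    by (subst nn_integral_multc) auto
  also have "\<dots> = emeasure lborel A * emeasure lborel B"
    by (subst flip) (auto simp: indB nn_integral_cmult)
  finally have "(\<integral>\<^sup>+x. indicator A (f x) \<partial>lborel) = emeasure lborel A"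
    using eB by (metis ennreal_mult_cancel_left infinity_ennreal_def mult.commute)
  moreover have "(\<integral>\<^sup>+x. indicator A (f x) \<partial>lborel) = emeasure (distr lborel borel f) A"
    by (simp add: nn_integral_distr nn_integral_indicator[of A "distr lborel borel f", symmetric]
        del: nn_integral_indicator)
  ultimately show "emeasure (distr lborel borel f) A = emeasure lborel A"
    by simp
qed auto

lemma linear_reflect: "linear (reflect v)"
  by (rule linearI) (simp_all add: reflect_def algebra_simps inner_add_left)

lemma reflect_reflect:
  assumes "norm v = 1" shows "reflect v (reflect v x) = x"
proof -
  have "v \<bullet> v = 1" using assms by (simp add: norm_eq_1)
  then show ?thesis by (simp add: reflect_def inner_diff_left algebra_simps)
qed

lemma inner_reflect: "reflect v x \<bullet> y = x \<bullet> reflect v y"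
  by (simp add: reflect_def inner_diff_left inner_diff_right inner_commute)

lemma orthogonal_transformation_reflect:
  assumes "norm v = 1" shows "orthogonal_transformation (reflect v)"
  unfolding orthogonal_transformation_def
  by (simp add: linear_reflect inner_reflect reflect_reflect assms)

lemma norm_reflect: "norm v = 1 \<Longrightarrow> norm (reflect v x) = norm x"
  using orthogonal_transformation_reflect orthogonal_transformation_norm by blast

lemma continuous_on_reflect [continuous_intros]:
  "continuous_on S f \<Longrightarrow> continuous_on S (\<lambda>x. reflect v (f x))"
  unfolding reflect_def by (intro continuous_intros)

section \<open>Steiner symmetrization and support functions\<close>

lemma reflect_perp_add:
  assumes "norm u = 1" "x \<bullet> u = 0"
  shows "reflect u (x + s *\<^sub>R u) = x - s *\<^sub>R u"
proof -
  have "u \<bullet> u = 1" using assms by (simp add: norm_eq_1)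
  then have "(x + s *\<^sub>R u) \<bullet> u = s" using assms by (simp add: inner_add_left)
  moreover have "(2 * s) *\<^sub>R u = s *\<^sub>R u + s *\<^sub>R u" by (simp only: mult_2 scaleR_add_left)
  ultimately show ?thesis by (simp add: reflect_def)
qed

lemma midpoint_along_line:
  fixes x u :: "'a::real_vector"
  shows "(1/2) *\<^sub>R ((x + a *\<^sub>R u) + (x - b *\<^sub>R u)) = x + ((a - b) / 2) *\<^sub>R u"
proof -
  have "2 * ((a - b) / 2) = a - b" by simp
  then have "(x + a *\<^sub>R u) + (x - b *\<^sub>R u) = 2 *\<^sub>R (x + ((a - b) / 2) *\<^sub>R u)"
    by (simp only: scaleR_add_right scaleR_2[of x] scaleR_scaleR) (simp add: scaleR_diff_left)
  then show ?thesis by (simp only: scaleR_scaleR) simp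
qed

lemma linear_proj_perp: "linear (proj_perp u)"
  by (rule linearI) (simp_all add: proj_perp_def algebra_simps inner_add_left)

text \<open>This form replaces the chord lengths by a linear image of a compact convex set, so that
  compactness, convexity and the bound on the support function need no further work on chords.\<close>
lemma steiner_eq_image:
  fixes K :: "'a::euclidean_space set"
  assumes u: "norm u = 1" and K: "compact K" "convex K"
  shows "steiner u K = (\<lambda>(a, b). (1/2) *\<^sub>R (a + reflect u b)) ` {(a, b) \<in> K \<times> K. proj_perp u a = proj_perp u b}"
    (is "_ = ?f ` ?C")
proof -
  have uu: "u \<bullet> u = 1" using u by (simp add: norm_eq_1)
  define T where "T x = {t. x + t *\<^sub>R u \<in> K}" for x
  have T: "T x = (\<lambda>y. (y - x) \<bullet> u) ` (K \<inter> range (\<lambda>t. x + t *\<^sub>R u))" for x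
  proof (intro equalityI subsetI)
    fix t assume "t \<in> T x"
    then show "t \<in> (\<lambda>y. (y - x) \<bullet> u) ` (K \<inter> range (\<lambda>t. x + t *\<^sub>R u))"
      by (intro image_eqI[where x = "x + t *\<^sub>R u"]) (auto simp: T_def uu)
  qed (auto simp: T_def uu)
  have cT: "compact (T x)" for x
  proof -
    have "closed (range (\<lambda>t. x + t *\<^sub>R u))"
    proof -
      have "closed (range (\<lambda>t. t *\<^sub>R u))"
        using closed_subspace[OF subspace_span[of "{u}"]] by (simp add: span_singleton)
      from closed_translation[OF this, of x] show ?thesis
        by (simp add: image_image)
    qed
    then show ?thesis unfolding T
      by (intro compact_continuous_image continuous_intros compact_Int_closed K)
  qed
  have bT: "bdd_above (T x)" "bdd_below (T x)" for x
    by (simp_all add: cT compact_imp_bounded bounded_imp_bdd_above bounded_imp_bdd_below)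
  have iT: "t \<in> T x" if "r \<in> T x" "s \<in> T x" "r \<le> t" "t \<le> s" for r s t x
  proof -
    have "convex (T x)"
    proof -
      have "T x = (\<lambda>t. t *\<^sub>R u) -` ((\<lambda>y. y - x) ` K)"
      proof (intro equalityI subsetI)
        fix t assume "t \<in> (\<lambda>t. t *\<^sub>R u) -` ((\<lambda>y. y - x) ` K)"
        then obtain y where "y \<in> K" "t *\<^sub>R u = y - x" by auto
        then show "t \<in> T x" by (simp add: T_def)
      next
        fix t assume "t \<in> T x"
        then show "t \<in> (\<lambda>t. t *\<^sub>R u) -` ((\<lambda>y. y - x) ` K)"
          unfolding T_def vimage_def mem_Collect_eq by (rule rev_image_eqI) simp
      qed
      moreover have "linear (\<lambda>t. t *\<^sub>R u)"
        by (rule linearI) (simp_all add: algebra_simps)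
      ultimately show ?thesis
        using K(2) by (simp add: convex_linear_vimage convex_translation_subtract)
    qed
    then have "is_interval (T x)" by (simp add: is_interval_convex_1)
    then show ?thesis using that by (rule mem_is_interval_1_I)
  qed
  have chord: "chord_len u K x = Sup (T x) - Inf (T x)" for x
    by (simp add: chord_len_def T_def)
  show ?thesis
  proof (intro equalityI subsetI)
    fix z assume "z \<in> steiner u K"
    then obtain x t where z: "z = x + t *\<^sub>R u" and x: "x \<in> proj_perp u ` K"
      and t: "\<bar>t\<bar> \<le> chord_len u K x / 2"
      unfolding steiner_def mem_Collect_eq by (elim exE conjE)
    obtain y where x_def: "x = proj_perp u y" and y: "y \<in> K"
      using x by (rule imageE)
    have xu: "x \<bullet> u = 0" by (simp add: x_def proj_perp_def inner_diff_left uu)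
    have "y \<bullet> u \<in> T x" using y by (simp add: T_def x_def proj_perp_def)
    then have ne: "T x \<noteq> {}" by auto
    \<comment> \<open>\<open>m\<close> is the height of the midpoint of the chord. The points of
      \<open>K\<close> at heights \<open>m + t\<close> and \<open>m - t\<close> produce
      \<open>z\<close>: reflecting the second and averaging yields height \<open>t\<close>.\<close>
    define m where "m = (Sup (T x) + Inf (T x)) / 2"
    have S: "Sup (T x) \<in> T x" "Inf (T x) \<in> T x"
      by (simp_all add: closed_contains_Sup closed_contains_Inf cT compact_imp_closed ne bT)
    have t': "\<bar>t\<bar> \<le> (Sup (T x) - Inf (T x)) / 2" using t by (simp add: chord)
    have "m + t \<in> T x" "m - t \<in> T x"
      using t' by (auto intro!: iT[OF S(2,1)] simp: m_def abs_le_iff field_simps)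
    moreover have "proj_perp u (x + s *\<^sub>R u) = x" for s
      by (simp add: proj_perp_def inner_add_left uu xu)
    ultimately have C: "(x + (m + t) *\<^sub>R u, x + (m - t) *\<^sub>R u) \<in> ?C"
      by (simp only: T_def mem_Collect_eq case_prod_conv mem_Sigma_iff simp_thms)
    have fz: "?f (x + (m + t) *\<^sub>R u, x + (m - t) *\<^sub>R u) = z"
      by (simp only: case_prod_conv reflect_perp_add[OF u xu] midpoint_along_line) (simp add: z)
    show "z \<in> ?f ` ?C" using imageI[OF C, of ?f] unfolding fz .
  next
    fix z assume "z \<in> ?f ` ?C"
    then obtain p where p: "p \<in> ?C" "z = ?f p" by (rule imageE)
    obtain a b where "p = (a, b)" by (cases p)
    with p have ab: "a \<in> K" "b \<in> K" "proj_perp u a = proj_perp u b"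
      and z: "z = (1/2) *\<^sub>R (a + reflect u b)" by simp_all
    define x where "x = proj_perp u a"
    define t where "t = (a \<bullet> u - b \<bullet> u) / 2"
    have a: "x + (a \<bullet> u) *\<^sub>R u = a" by (simp add: x_def proj_perp_def)
    have b: "x + (b \<bullet> u) *\<^sub>R u = b" unfolding x_def ab(3) by (simp add: proj_perp_def)
    have T1: "a \<bullet> u \<in> T x" "b \<bullet> u \<in> T x" using a b ab by (auto simp: T_def)
    have "\<bar>t\<bar> \<le> chord_len u K x / 2"
      using cSup_upper[OF T1(1)] cSup_upper[OF T1(2)] cInf_lower[OF T1(1)] cInf_lower[OF T1(2)] bT
      by (force simp: t_def chord abs_le_iff)
    moreover have "z = x + t *\<^sub>R u"
    proof -
      have "x \<bullet> u = 0" by (simp add: x_def proj_perp_def inner_diff_left uu)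
      then have "reflect u b = x - (b \<bullet> u) *\<^sub>R u" using b reflect_perp_add[OF u, of x "b \<bullet> u"] by simp
      then have "z = (1/2) *\<^sub>R ((x + (a \<bullet> u) *\<^sub>R u) + (x - (b \<bullet> u) *\<^sub>R u))" using z a by simp
      then show ?thesis by (simp only: midpoint_along_line t_def)
    qed
    moreover have "x \<in> proj_perp u ` K" unfolding x_def using ab(1) by (rule imageI)
    ultimately show "z \<in> steiner u K"
      unfolding steiner_def mem_Collect_eq by (intro exI conjI)
  qed
qed

text \<open>Pairs of points on a common chord form \<open>K \<times> K\<close> cut by the kernel of
  a linear map, a compact convex set; the map in \<open>steiner_eq_image\<close> is linear and so
  preserves both properties.\<close>

lemma
  fixes K :: "'a::euclidean_space set"
  assumes u: "norm u = 1" and K: "compact K" "convex K"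
  shows compact_steiner: "compact (steiner u K)"
    and convex_steiner: "convex (steiner u K)"
proof -
  define C where "C = {(a, b) \<in> K \<times> K. proj_perp u a = proj_perp u b}"
  have C: "C = (K \<times> K) \<inter> (\<lambda>p. proj_perp u (fst p - snd p)) -` {0}"
    by (auto simp: C_def linear_diff[OF linear_proj_perp])
  have lin: "linear (\<lambda>p. proj_perp u (fst p - snd p))"
    using linear_compose[OF linear_compose_sub[OF linear_fst linear_snd] linear_proj_perp, of u]
    by (simp add: o_def)
  have "closed ((\<lambda>p. proj_perp u (fst p - snd p)) -` {0})"
    unfolding proj_perp_def by (intro continuous_closed_vimage continuous_intros closed_singleton)
  then have "compact C"
    unfolding C by (intro compact_Int_closed compact_Times K)
  moreover have "convex C"
    unfolding C by (intro convex_Int convex_Times convex_linear_vimage[OF lin] K convex_singleton)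
  moreover have lin2: "linear (\<lambda>(a, b). (1/2) *\<^sub>R (a + reflect u b))"
    by (rule linearI) (auto simp: algebra_simps linear_add[OF linear_reflect] linear_cmul[OF linear_reflect])
  ultimately show "compact (steiner u K)" "convex (steiner u K)"
    unfolding steiner_eq_image[OF assms] C_def[symmetric]
    by (simp_all add: compact_continuous_image linear_continuous_on convex_linear_image
        linear_conv_bounded_linear[THEN iffD1])
qed

lemma steiner_nonempty:
  assumes "norm u = 1" "compact K" "convex K" "K \<noteq> {}"
  shows "steiner u K \<noteq> {}"
proof -
  obtain a where "a \<in> K" using assms by blast
  then have "(a, a) \<in> {(a, b) \<in> K \<times> K. proj_perp u a = proj_perp u b}" by simp
  then show ?thesis unfolding steiner_eq_image[OF assms(1-3)] by blast
qed

lemma steiner_subset_cball: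
  assumes "norm u = 1" "compact K" "convex K" "K \<subseteq> cball 0 r"
  shows "steiner u K \<subseteq> cball 0 r"
proof
  fix z assume "z \<in> steiner u K"
  then obtain a b where "a \<in> K" "b \<in> K" and z: "z = (1/2) *\<^sub>R (a + reflect u b)"
    by (auto simp: steiner_eq_image assms)
  then have "norm a \<le> r" "norm (reflect u b) \<le> r" using assms by (auto simp: norm_reflect)
  then show "z \<in> cball 0 r" using norm_triangle_ineq[of a "reflect u b"] by (simp add: z)
qed

section \<open>Support functions of compact sets, and distances read off from them\<close>

definition support_fun :: "'a::euclidean_space set \<Rightarrow> 'a \<Rightarrow> real" where
  "support_fun K y = (SUP x\<in>K. x \<bullet> y)"

lemma inner_le_support_fun:
  assumes "compact K" "x \<in> K"
  shows "x \<bullet> y \<le> support_fun K y"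
  unfolding support_fun_def
  by (intro cSUP_upper assms bounded_imp_bdd_above compact_imp_bounded compact_continuous_image
      continuous_intros)

lemma support_fun_le:
  assumes "K \<noteq> {}" "\<And>x. x \<in> K \<Longrightarrow> x \<bullet> y \<le> c"
  shows "support_fun K y \<le> c"
  unfolding support_fun_def using assms by (intro cSUP_least)

text \<open>Forgetting that \<open>a\<close> and \<open>b\<close> lie on the same chord leaves two
  independent suprema, which together give the support function of the Minkowski average of
  \<open>K\<close> and its reflection.\<close>

lemma support_fun_steiner_le:
  assumes "norm u = 1" "compact K" "convex K" "K \<noteq> {}"
  shows "support_fun (steiner u K) y \<le> (support_fun K y + support_fun K (reflect u y)) / 2"
proof (rule support_fun_le)
  show "steiner u K \<noteq> {}" using assms by (rule steiner_nonempty)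
  fix z assume "z \<in> steiner u K"
  then obtain a b where "a \<in> K" "b \<in> K" and z: "z = (1/2) *\<^sub>R (a + reflect u b)"
    by (auto simp: steiner_eq_image assms)
  then show "z \<bullet> y \<le> (support_fun K y + support_fun K (reflect u y)) / 2"
    using inner_le_support_fun[OF \<open>compact K\<close>, of a y] inner_le_support_fun[OF \<open>compact K\<close>, of b "reflect u y"]
    by (simp add: inner_add_left inner_reflect)
qed

lemma abs_support_fun_le:
  assumes "compact K" "K \<noteq> {}" "K \<subseteq> cball 0 r"
  shows "\<bar>support_fun K y\<bar> \<le> r * norm y"
proof -
  have *: "\<bar>x \<bullet> y\<bar> \<le> r * norm y" if "x \<in> K" for x
    using Cauchy_Schwarz_ineq2[of x y] mult_right_mono[of "norm x" r "norm y"] that assms by force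
  then have "support_fun K y \<le> r * norm y" by (intro support_fun_le assms) (auto simp: abs_le_iff)
  moreover obtain x where "x \<in> K" using assms by auto
  then have "- (r * norm y) \<le> support_fun K y"
    using *[of x] inner_le_support_fun[of K x y] assms by (auto simp: abs_le_iff)
  ultimately show ?thesis by (simp add: abs_le_iff)
qed

lemma support_fun_add_le:
  assumes "compact K" "K \<noteq> {}"
  shows "support_fun K (y + z) \<le> support_fun K y + support_fun K z"
  using assms by (intro support_fun_le) (auto simp: inner_add_right intro!: add_mono inner_le_support_fun)

text \<open>Subadditivity bounds the difference by the support function at \<open>y - z\<close> or
  at \<open>z - y\<close>.\<close>

lemma support_fun_lipschitz:
  assumes "compact K" "K \<noteq> {}" "K \<subseteq> cball 0 r"
  shows "\<bar>support_fun K y - support_fun K z\<bar> \<le> r * norm (y - z)"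
  using support_fun_add_le[of K z "y - z"] support_fun_add_le[of K y "z - y"]
    abs_support_fun_le[of K r "y - z"] abs_support_fun_le[of K r "z - y"] assms
  by (simp add: norm_minus_commute abs_le_iff)

text \<open>At the point \<open>b\<close> of \<open>B\<close> nearest to \<open>a\<close>, the
  hyperplane orthogonal to \<open>a - b\<close> supports \<open>B\<close>; for the unit vector
  \<open>y\<close> along \<open>a - b\<close> the hypothesis then yields
  \<open>norm (a - b) \<le> e\<close>. This converts estimates of support functions on the unit ball
  into distances between sets.\<close>

lemma infdist_le_support_fun:
  fixes B :: "'a::euclidean_space set"
  assumes B: "compact B" "convex B" "B \<noteq> {}" and "0 \<le> e"
    and le: "\<And>y. norm y \<le> 1 \<Longrightarrow> a \<bullet> y \<le> support_fun B y + e"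
  shows "infdist a B \<le> e"
proof -
  define b where "b = closest_point B a"
  have bB: "b \<in> B" using B by (simp add: b_def closest_point_in_set compact_imp_closed)
  have "dist a b \<le> e"
  proof (cases "a = b")
    case False
    define y where "y = (1 / norm (a - b)) *\<^sub>R (a - b)"
    have n: "norm y = 1" using False by (simp add: y_def)
    have "x \<bullet> y \<le> b \<bullet> y" if "x \<in> B" for x
    proof -
      have "(a - b) \<bullet> (x - b) \<le> 0"
        unfolding b_def using closest_point_dot[of B x a] B that compact_imp_closed by blast
      then have "x \<bullet> (a - b) \<le> b \<bullet> (a - b)" by (simp add: inner_diff_right inner_diff_left inner_commute)
      then show ?thesis by (simp add: y_def divide_right_mono)
    qed
    then have "support_fun B y \<le> b \<bullet> y" by (rule support_fun_le[OF B(3)])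
    then have "(a - b) \<bullet> y \<le> e" using le[of y] n by (simp add: inner_diff_left)
    moreover have "(a - b) \<bullet> y = norm (a - b)" using False
      by (simp add: y_def dot_square_norm power2_eq_square)
    ultimately show ?thesis by (simp add: dist_norm)
  qed (use \<open>0 \<le> e\<close> in simp)
  then show ?thesis using infdist_le2[OF bB] by blast
qed

section \<open>Sequences dominated by reflection averages\<close>

text \<open>The plain integral of a continuous function over the ball does not change when the
  function is averaged with its reflection, whereas this strictly convex functional drops unless the
  function is already symmetric. There is no division by the volume, as only comparisons
  matter.\<close>

definition exp_mean :: "('a::euclidean_space \<Rightarrow> real) \<Rightarrow> real" where
  "exp_mean f = (LINT y:cball 0 1|lborel. exp (f y))"

lemma set_integrable_cball:
  fixes f :: "'a::euclidean_space \<Rightarrow> real"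
  shows "continuous_on (cball a r) f \<Longrightarrow> set_integrable lborel (cball a r) f"
  unfolding set_integrable_def by (rule borel_integrable_compact) auto

lemma exp_mean_integrand_measurable:
  fixes f :: "'a::euclidean_space \<Rightarrow> real"
  assumes "continuous_on (cball 0 1) f"
  shows "(\<lambda>y. indicator (cball 0 1) y *\<^sub>R exp (f y)) \<in> borel_measurable lborel"
  using set_integrable_cball[OF continuous_on_exp[OF assms]]
  unfolding set_integrable_def by (rule borel_measurable_integrable)

lemma exp_mean_mono:
  assumes "continuous_on (cball 0 1) f" "continuous_on (cball 0 1) g"
    and "\<And>y. y \<in> cball 0 1 \<Longrightarrow> f y \<le> g y"
  shows "exp_mean f \<le> exp_mean g"
  unfolding exp_mean_def using assms
  by (intro set_integral_mono set_integrable_cball continuous_intros) auto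

lemma exp_mean_nonneg: "0 \<le> exp_mean f"
  unfolding exp_mean_def set_lebesgue_integral_def by (intro Bochner_Integration.integral_nonneg) (auto simp: indicator_def)

lemma continuous_on_cball_reflect:
  assumes "norm v = 1" "continuous_on (cball 0 1) f"
  shows "continuous_on (cball 0 1) (\<lambda>y. f (reflect v y))"
  by (rule continuous_on_compose2[OF assms(2)]) (auto intro!: continuous_intros simp: norm_reflect assms)

lemma continuous_on_cball_average:
  assumes "norm v = 1" "continuous_on (cball 0 1) f"
  shows "continuous_on (cball 0 1) (\<lambda>y. (f y + f (reflect v y)) / 2 :: real)"
  using assms(2) continuous_on_cball_reflect[OF assms] by (intro continuous_intros) simp_all

lemma exp_mean_reflect:
  assumes v: "norm v = 1" and f: "continuous_on (cball 0 1) f"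
  shows "exp_mean (\<lambda>y. f (reflect v y)) = exp_mean f"
proof -
  have meas: "(\<lambda>y. indicator (cball 0 1) y *\<^sub>R exp (f y)) \<in> borel_measurable borel"
    using exp_mean_integrand_measurable[OF f] by simp
  have "reflect v \<in> borel_measurable borel"
    by (intro borel_measurable_continuous_onI continuous_intros)
  then have "(LINT y|distr lborel borel (reflect v). indicator (cball 0 1) y *\<^sub>R exp (f y))
      = (LINT y|lborel. indicator (cball 0 1) (reflect v y) *\<^sub>R exp (f (reflect v y)))"
    by (subst integral_distr[OF _ meas]) simp_all
  then show ?thesis
    by (simp add: lborel_distr_orthogonal_transformation orthogonal_transformation_reflect v
        exp_mean_def set_lebesgue_integral_def indicator_def norm_reflect)
qed

text \<open>The continuous difference \<open>q - p\<close> is nonnegative with integral zero, so it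
  vanishes on the ball, boundary included.\<close>

lemma set_integral_cball_eqD:
  fixes p q :: "'a::euclidean_space \<Rightarrow> real"
  assumes p: "continuous_on (cball 0 1) p" and q: "continuous_on (cball 0 1) q"
    and le: "\<And>y. y \<in> cball 0 1 \<Longrightarrow> p y \<le> q y"
    and int: "(LINT y:cball 0 1|lborel. q y) \<le> (LINT y:cball 0 1|lborel. p y)"
    and y: "y \<in> cball 0 1"
  shows "p y = q y"
proof -
  note I = set_integrable_cball[OF p] set_integrable_cball[OF q]
  have "(LINT y:cball 0 1|lborel. p y) \<le> (LINT y:cball 0 1|lborel. q y)"
    using I le by (rule set_integral_mono)
  with int have 0: "(LINT y:cball 0 1|lborel. q y - p y) = 0"
    by (simp add: set_integral_diff I)
  have "set_integrable lborel (cball 0 1) (\<lambda>y. q y - p y)"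
    by (simp add: I set_integral_diff)
  from set_borel_integral_eq_integral[OF this] 0
  have "((\<lambda>y. q y - p y) has_integral 0) (cball 0 1)"
    by (metis integrable_integral)
  \<comment> \<open>The sphere is a null set, so the closed ball can be treated as the closure of
    the open one.\<close>
  then have hi: "((\<lambda>y. q y - p y) has_integral 0) (closure (ball 0 1))"
    by simp
  have "q y - p y = 0"
  proof (rule has_integral_0_closure_imp_0[OF _ _ _ _ _ _ hi])
    show "continuous_on (closure (ball 0 1)) (\<lambda>y. q y - p y)"
      by (simp add: continuous_on_diff p q)
    show "0 < emeasure lborel (ball 0 1 :: 'a set)"
      by (simp add: emeasure_ball unit_ball_vol_pos)
    show "emeasure lborel (ball 0 1 :: 'a set) < \<infinity>"
      by (rule emeasure_lborel_ball_finite)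
    show "emeasure lborel (closure (ball 0 1 :: 'a set)) = emeasure lborel (ball 0 1 :: 'a set)"
      by (simp add: emeasure_ball emeasure_cball)
  qed (use le y in auto)
  then show ?thesis by simp
qed

text \<open>The square of \<open>exp (a/2) - exp (b/2)\<close> is exactly twice the gap in the
  convexity inequality, which gives both the bound and its equality case.\<close>

lemma exp_midpoint_le:
  fixes a b :: real
  shows "exp ((a + b) / 2) \<le> (exp a + exp b) / 2"
    and "exp ((a + b) / 2) = (exp a + exp b) / 2 \<Longrightarrow> a = b"
proof -
  have sq: "(exp (a/2) - exp (b/2))\<^sup>2 = exp a + exp b - 2 * exp ((a + b) / 2)"
    by (simp add: power2_eq_square algebra_simps add_divide_distrib flip: exp_add)
  moreover have "0 \<le> (exp (a/2) - exp (b/2))\<^sup>2" by simp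
  ultimately show "exp ((a + b) / 2) \<le> (exp a + exp b) / 2"
    by simp
  assume "exp ((a + b) / 2) = (exp a + exp b) / 2"
  then have "(exp (a/2) - exp (b/2))\<^sup>2 = 0"
    using sq by simp
  then show "a = b" by simp
qed

text \<open>The midpoint inequality for the exponential is integrated; reflection invariance
  identifies the integral of its right side with \<open>exp_mean f\<close>. If nothing is lost,
  continuity forces equality at every point, hence symmetry.\<close>

lemma
  assumes v: "norm v = 1" and f: "continuous_on (cball 0 1) f"
  defines "g \<equiv> \<lambda>y. (f y + f (reflect v y)) / 2"
  shows exp_mean_average_le: "exp_mean g \<le> exp_mean f"
    and exp_mean_average_eqD: "exp_mean f \<le> exp_mean g \<Longrightarrow> y \<in> cball 0 1 \<Longrightarrow> f (reflect v y) = f y"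
proof -
  let ?B = "cball 0 1 :: 'a set"
  have f': "continuous_on ?B (\<lambda>y. f (reflect v y))" by (rule continuous_on_cball_reflect[OF v f])
  have c: "continuous_on ?B (\<lambda>y. exp (g y))" "continuous_on ?B (\<lambda>y. (exp (f y) + exp (f (reflect v y))) / 2)"
    unfolding g_def by (intro continuous_intros f f'; simp)+
  have "(LINT y:?B|lborel. (exp (f y) + exp (f (reflect v y))) / 2)
      = (exp_mean f + exp_mean (\<lambda>y. f (reflect v y))) / 2"
    unfolding exp_mean_def
    by (simp add: set_integral_add set_integrable_cball continuous_on_exp f f')
  then have eq: "(LINT y:?B|lborel. (exp (f y) + exp (f (reflect v y))) / 2) = exp_mean f"
    by (simp add: exp_mean_reflect v f)
  have "exp_mean g \<le> (LINT y:?B|lborel. (exp (f y) + exp (f (reflect v y))) / 2)"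
    unfolding exp_mean_def
    by (intro set_integral_mono set_integrable_cball c) (simp only: g_def exp_midpoint_le)
  then show "exp_mean g \<le> exp_mean f" by (simp only: eq)
  assume "exp_mean f \<le> exp_mean g" and y: "y \<in> ?B"
  have "exp (g y) = (exp (f y) + exp (f (reflect v y))) / 2"
  proof (intro set_integral_cball_eqD[OF c _ _ y])
    show "exp (g z) \<le> (exp (f z) + exp (f (reflect v z))) / 2" for z
      unfolding g_def by (rule exp_midpoint_le)
    show "(LINT y:?B|lborel. (exp (f y) + exp (f (reflect v y))) / 2) \<le> (LINT y:?B|lborel. exp (g y))"
      unfolding eq using \<open>exp_mean f \<le> exp_mean g\<close> by (simp only: exp_mean_def)
  qed
  then show "f (reflect v y) = f y"
    unfolding g_def using exp_midpoint_le(2) by metis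
qed

text \<open>Strict monotonicity of the mean; it serves to identify limit functions that lie below
  \<open>g\<close>.\<close>

lemma exp_mean_eqD:
  assumes "continuous_on (cball 0 1) f" "continuous_on (cball 0 1) g"
    and "\<And>y. y \<in> cball 0 1 \<Longrightarrow> f y \<le> g y"
    and "exp_mean g \<le> exp_mean f" "y \<in> cball 0 1"
  shows "f y = g y"
  using set_integral_cball_eqD[of "\<lambda>y. exp (f y)" "\<lambda>y. exp (g y)" y] assms
  by (simp add: exp_mean_def continuous_on_exp)

lemma exp_mean_tendsto:
  fixes f :: "nat \<Rightarrow> 'a::euclidean_space \<Rightarrow> real"
  assumes f: "\<And>n. continuous_on (cball 0 1) (f n)" and g: "continuous_on (cball 0 1) g"
    and bound: "\<And>n y. y \<in> cball 0 1 \<Longrightarrow> \<bar>f n y\<bar> \<le> M"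
    and lim: "\<And>y. y \<in> cball 0 1 \<Longrightarrow> (\<lambda>n. f n y) \<longlonglongrightarrow> g y"
  shows "(\<lambda>n. exp_mean (f n)) \<longlonglongrightarrow> exp_mean g"
  unfolding exp_mean_def set_lebesgue_integral_def
proof (rule integral_dominated_convergence[where w = "\<lambda>y. indicator (cball 0 1) y *\<^sub>R exp M"])
  show "(\<lambda>y. indicator (cball 0 1) y *\<^sub>R exp (g y)) \<in> borel_measurable lborel"
    "(\<lambda>y. indicator (cball 0 1) y *\<^sub>R exp (f n y)) \<in> borel_measurable lborel" for n
    by (rule exp_mean_integrand_measurable f g)+
  show "integrable lborel (\<lambda>y::'a. indicator (cball 0 1) y *\<^sub>R exp M)"
    using set_integrable_cball[of 0 1 "\<lambda>y. exp M"] by (simp add: set_integrable_def)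
  show "AE y in lborel. (\<lambda>n. indicator (cball 0 1) y *\<^sub>R exp (f n y)) \<longlonglongrightarrow> indicator (cball 0 1) y *\<^sub>R exp (g y)"
    by (rule AE_I2) (auto simp: indicator_def intro!: tendsto_exp lim)
  show "AE y in lborel. norm (indicator (cball 0 1) y *\<^sub>R exp (f n y)) \<le> indicator (cball 0 1) y *\<^sub>R exp M" for n
    using bound[of _ n] by (intro AE_I2) (auto simp: indicator_def abs_le_iff)
qed

text \<open>Isolates what the convergence argument takes from the support functions of the iterates:
  a common bound and Lipschitz constant for compactness, and the one-sided averaging inequality
  \<open>step\<close>.\<close>

locale reflected_averaging =
  fixes u :: "nat \<Rightarrow> 'a::euclidean_space" and f :: "nat \<Rightarrow> 'a \<Rightarrow> real" and r :: real
  assumes finite_directions: "finite (range u)"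
    and unit: "norm (u i) = 1"
    and bounded: "y \<in> cball 0 1 \<Longrightarrow> \<bar>f i y\<bar> \<le> r"
    and lipschitz: "\<bar>f i y - f i z\<bar> \<le> r * norm (y - z)"
    and step: "f (Suc i) y \<le> (f i y + f i (reflect (u i) y)) / 2"
begin

abbreviation "B \<equiv> cball 0 1 :: 'a set"

lemma r_nonneg: "0 \<le> r"
  using bounded[of 0 0] by simp

lemma cont: "continuous_on S (f i)"
proof -
  have "r-lipschitz_on S (f i)"
    using lipschitz r_nonneg by (auto simp: lipschitz_on_def dist_norm)
  then show ?thesis by (rule lipschitz_on_continuous_on)
qed

text \<open>Arzela-Ascoli, with equicontinuity from the common Lipschitz constant. The free index
  map \<open>s\<close> allows extraction from times already selected, monotone or not.\<close>

lemma convergent_subsequence: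
  fixes s :: "nat \<Rightarrow> nat"
  obtains g k where "continuous_on B g" "strict_mono (k :: nat \<Rightarrow> nat)"
    "uniform_limit B (\<lambda>n. f (s (k n))) g sequentially"
proof -
  obtain g k where g: "continuous_on B g" and k: "strict_mono (k :: nat \<Rightarrow> nat)"
    and lim: "\<And>e. 0 < e \<Longrightarrow> \<exists>N. \<forall>n x. n \<ge> N \<and> x \<in> B \<longrightarrow> norm (f (s (k n)) x - g x) < e"
  proof (rule Arzela_Ascoli[of B "\<lambda>n. f (s n)" r])
    fix x e assume "x \<in> B" and e: "0 < (e::real)"
    \<comment> \<open>The radius has the denominator \<open>r + 1\<close> because \<open>r\<close>
      may be zero.\<close>
    have "\<bar>f (s n) x - f (s n) y\<bar> < e" if "norm (x - y) < e / (r + 1)" for n y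
    proof -
      have "\<bar>f (s n) x - f (s n) y\<bar> \<le> (r + 1) * norm (x - y)"
        using lipschitz[of "s n" x y] norm_ge_zero[of "x - y"]
        unfolding distrib_right by linarith
      also have "\<dots> < e" using that r_nonneg by (simp add: field_simps)
      finally show ?thesis .
    qed
    then show "\<exists>d. 0 < d \<and> (\<forall>n y. y \<in> B \<and> norm (x - y) < d \<longrightarrow> norm (f (s n) x - f (s n) y) < e)"
      using e r_nonneg by (intro exI[of _ "e / (r + 1)"]) auto
  qed (use bounded in auto)
  show ?thesis
  proof (rule that[OF g k])
    show "uniform_limit B (\<lambda>n. f (s (k n))) g sequentially"
      using lim unfolding uniform_limit_iff eventually_sequentially by (metis dist_norm)
  qed
qed

lemma exp_mean_tendsto_sub:
  fixes s :: "nat \<Rightarrow> nat"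
  assumes "continuous_on B g" "uniform_limit B (\<lambda>n. f (s n)) g sequentially"
  shows "(\<lambda>n. exp_mean (f (s n))) \<longlonglongrightarrow> exp_mean g"
  using assms by (intro exp_mean_tendsto[where M = r] cont bounded tendsto_uniform_limitI)

text \<open>If convergence failed, a subsequence would stay at uniform distance at least
  \<open>e\<close> from \<open>g\<close>. A limit \<open>h\<close> of part of it satisfies
  \<open>h \<le> g\<close> by domination and has the same mean, so strict monotonicity gives
  \<open>h = g\<close>, a contradiction.\<close>

lemma uniform_limit_if_dominated:
  fixes s :: "nat \<Rightarrow> nat"
  assumes g: "continuous_on B g"
    and dom: "\<And>e. e > 0 \<Longrightarrow> \<forall>\<^sub>F n in sequentially. \<forall>y\<in>B. f (s n) y \<le> g y + e"
    and mean: "(\<lambda>n. exp_mean (f (s n))) \<longlonglongrightarrow> exp_mean g"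
  shows "uniform_limit B (\<lambda>n. f (s n)) g sequentially"
proof (rule ccontr)
  assume "\<not> ?thesis"
  then obtain e where e: "e > 0"
    and "\<not> (\<forall>\<^sub>F n in sequentially. \<forall>y\<in>B. dist (f (s n) y) (g y) < e)"
    unfolding uniform_limit_iff by blast
  then obtain q :: "nat \<Rightarrow> nat" where q: "strict_mono q"
    and far: "\<And>n. \<not> (\<forall>y\<in>B. dist (f (s (q n)) y) (g y) < e)"
    using not_eventually_sequentiallyD by blast
  obtain h k where h: "continuous_on B h" and k: "strict_mono (k :: nat \<Rightarrow> nat)"
    and lim: "uniform_limit B (\<lambda>n. f (s (q (k n)))) h sequentially"
    using convergent_subsequence[of "\<lambda>n. s (q n)"] by blast
  have qk: "strict_mono (q \<circ> k)" using q k by (rule strict_mono_o)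
  have "h y \<le> g y" if y: "y \<in> B" for y
  proof (rule field_le_epsilon)
    fix d :: real assume "0 < d"
    from dom[OF this] have "\<forall>\<^sub>F n in sequentially. f (s n) y \<le> g y + d"
      by eventually_elim (use y in auto)
    then have "\<forall>\<^sub>F n in sequentially. f (s (q (k n))) y \<le> g y + d"
      using eventually_subseq[OF qk] by simp
    then show "h y \<le> g y + d"
      using tendsto_uniform_limitI[OF lim y] by (intro tendsto_upperbound) auto
  qed
  moreover have "exp_mean h = exp_mean g"
    using LIMSEQ_subseq_LIMSEQ[OF mean qk] exp_mean_tendsto_sub[OF h lim]
    by (intro LIMSEQ_unique) (auto simp: o_def)
  ultimately have "h y = g y" if "y \<in> B" for y
    using exp_mean_eqD[OF h g] that by simp
  moreover obtain n where "\<forall>y\<in>B. dist (f (s (q (k n))) y) (h y) < e"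
    using uniform_limitD[OF lim e] by (auto simp: eventually_sequentially)
  ultimately show False using far[of "k n"] by auto
qed

text \<open>The means decrease along the full sequence, so their limit along one subsequence is
  their limit overall.\<close>

lemma exp_mean_tendsto_limit:
  assumes "continuous_on B g" "strict_mono k" "uniform_limit B (\<lambda>n. f (k n)) g sequentially"
  shows "(\<lambda>i. exp_mean (f i)) \<longlonglongrightarrow> exp_mean g"
proof -
  have "exp_mean (f (Suc i)) \<le> exp_mean (f i)" for i
  proof -
    have "exp_mean (f (Suc i)) \<le> exp_mean (\<lambda>y. (f i y + f i (reflect (u i) y)) / 2)"
      by (intro exp_mean_mono cont step continuous_on_cball_average unit)
    also have "\<dots> \<le> exp_mean (f i)" by (intro exp_mean_average_le unit cont)
    finally show ?thesis .
  qed
  then have "decseq (\<lambda>i. exp_mean (f i))" by (intro decseq_SucI)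
  then obtain l where l: "(\<lambda>i. exp_mean (f i)) \<longlonglongrightarrow> l"
    using decseq_convergent exp_mean_nonneg by metis
  then have "(\<lambda>n. exp_mean (f (k n))) \<longlonglongrightarrow> l"
    using LIMSEQ_subseq_LIMSEQ[OF l assms(2)] by (simp add: o_def)
  then have "l = exp_mean g"
    using exp_mean_tendsto_sub[OF assms(1,3)] by (rule LIMSEQ_unique)
  with l show ?thesis by simp
qed

text \<open>The barrier \<open>g + c\<close> is unchanged by every reflection used, so an average of
  two values below it stays below it. The range excludes \<open>t = j\<close> because
  \<open>u t\<close> acts in the passage from time \<open>t\<close> to \<open>Suc t\<close>.\<close>

lemma upper_bound_persists:
  assumes "i \<le> j"
    and inv: "\<And>t y. i \<le> t \<Longrightarrow> t < j \<Longrightarrow> y \<in> B \<Longrightarrow> g (reflect (u t) y) = g y"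
    and start: "\<forall>y\<in>B. f i y \<le> g y + c"
  shows "\<forall>y\<in>B. f j y \<le> g y + c"
  using assms(1) inv
proof (induction j rule: dec_induct)
  case (step j)
  then have IH: "\<forall>y\<in>B. f j y \<le> g y + c" by simp
  show ?case
  proof
    fix y assume y: "y \<in> B"
    then have y': "reflect (u j) y \<in> B" by (simp add: norm_reflect unit)
    have "f (Suc j) y \<le> (f j y + f j (reflect (u j) y)) / 2" by (rule reflected_averaging.step[OF reflected_averaging_axioms])
    also have "\<dots> \<le> g y + c"
      using IH[rule_format, OF y] IH[rule_format, OF y'] step.prems[of j y] step.hyps y by simp
    finally show "f (Suc j) y \<le> g y + c" .
  qed
qed (use start in simp)

text \<open>Between a time \<open>k n\<close> and the next time at which a direction that does not fix the limit
  is used, the symmetries of the limit keep the functions below it, and the limit of the means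
  keeps them close to it.  Applying the new direction then costs nothing in the mean, which by
  strict convexity of the exponential means that it fixes the limit after all.\<close>
lemma limit_invariant:
  assumes g: "continuous_on B g" and k: "strict_mono k"
    and lim: "uniform_limit B (\<lambda>n. f (k n)) g sequentially"
    and v: "infinite {i. u i = v}" and y: "y \<in> B"
  shows "g (reflect v y) = g y"
proof (rule ccontr)
  assume ne: "g (reflect v y) \<noteq> g y"
  define J where "J = {w. \<forall>y\<in>B. g (reflect w y) = g y}"
  have "v \<notin> J" using ne y by (auto simp: J_def)
  then have ex: "\<exists>t. k n \<le> t \<and> u t \<notin> J" for n
    using v unfolding infinite_nat_iff_unbounded_le by blast
  define s where "s n = (LEAST t. k n \<le> t \<and> u t \<notin> J)" for n
  have s: "k n \<le> s n" "u (s n) \<notin> J" for n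
    using LeastI_ex[OF ex[of n]] by (auto simp: s_def)
  have before: "u t \<in> J" if "k n \<le> t" "t < s n" for n t
    using not_less_Least[of t "\<lambda>t. k n \<le> t \<and> u t \<notin> J"] that by (auto simp: s_def)
  have s_top: "filterlim s at_top sequentially"
    by (rule filterlim_at_top_mono[OF filterlim_subseq[OF k]]) (simp add: s)
  note mean = exp_mean_tendsto_limit[OF g k lim]
  have lim_s: "uniform_limit B (\<lambda>n. f (s n)) g sequentially"
  proof (rule uniform_limit_if_dominated[OF g])
    fix e :: real assume "e > 0"
    from uniform_limitD[OF lim this]
    show "\<forall>\<^sub>F n in sequentially. \<forall>y\<in>B. f (s n) y \<le> g y + e"
    proof eventually_elim
      case (elim n)
      show ?case
        by (rule upper_bound_persists[OF s(1)])
           (use elim before in \<open>force simp: J_def dist_real_def abs_less_iff\<close>)+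
    qed
  next
    show "(\<lambda>n. exp_mean (f (s n))) \<longlonglongrightarrow> exp_mean g"
      by (rule filterlim_compose[OF mean s_top])
  qed
  \<comment> \<open>By finiteness of the set of directions, one direction \<open>w\<close> outside
    \<open>J\<close> is used at infinitely many of the times \<open>s n\<close>.\<close>
  have "finite ((\<lambda>n. u (s n)) ` UNIV)"
    by (rule finite_subset[OF _ finite_directions]) auto
  then obtain w where w: "infinite {n. u (s n) = w}"
    using pigeonhole_infinite[of UNIV "\<lambda>n. u (s n)"] by auto
  obtain q :: "nat \<Rightarrow> nat" where q: "strict_mono q" and uq: "\<And>n. u (s (q n)) = w"
    using infinite_enumerate[OF w] by auto
  have nw: "norm w = 1" and wJ: "w \<notin> J" using unit[of "s (q 0)"] s(2)[of "q 0"] by (auto simp: uq)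
  \<comment> \<open>The means one step after the times \<open>s (q n)\<close> still tend to
    \<open>exp_mean g\<close>, while each is at most the mean of the averaged function, which
    converges to the right side.\<close>
  have "exp_mean g \<le> exp_mean (\<lambda>y. (g y + g (reflect w y)) / 2)"
  proof (rule LIMSEQ_le)
    have "filterlim (\<lambda>n. Suc (s (q n))) at_top sequentially"
      by (rule filterlim_compose[OF filterlim_Suc]) (rule filterlim_compose[OF s_top filterlim_subseq[OF q]])
    then show "(\<lambda>n. exp_mean (f (Suc (s (q n))))) \<longlonglongrightarrow> exp_mean g"
      by (rule filterlim_compose[OF mean])
    have *: "(\<lambda>n. f (s (q n)) y) \<longlonglongrightarrow> g y" if "y \<in> B" for y
      using filterlim_compose[OF tendsto_uniform_limitI[OF lim_s that] filterlim_subseq[OF q]] .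
    show "(\<lambda>n. exp_mean (\<lambda>y. (f (s (q n)) y + f (s (q n)) (reflect w y)) / 2))
        \<longlonglongrightarrow> exp_mean (\<lambda>y. (g y + g (reflect w y)) / 2)"
    proof (rule exp_mean_tendsto[where M = r])
      fix n y assume "y \<in> B"
      then show "\<bar>(f (s (q n)) y + f (s (q n)) (reflect w y)) / 2\<bar> \<le> r"
        using bounded[of y "s (q n)"] bounded[of "reflect w y" "s (q n)"]
        by (simp add: norm_reflect nw abs_le_iff)
    next
      fix y assume "y \<in> B"
      then show "(\<lambda>n. (f (s (q n)) y + f (s (q n)) (reflect w y)) / 2) \<longlonglongrightarrow> (g y + g (reflect w y)) / 2"
        by (intro tendsto_divide tendsto_add tendsto_const *) (simp_all add: norm_reflect nw)
    qed (intro continuous_on_cball_average nw cont g)+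
    have "exp_mean (f (Suc (s (q n)))) \<le> exp_mean (\<lambda>y. (f (s (q n)) y + f (s (q n)) (reflect w y)) / 2)" for n
      using step[of "s (q n)"]
      by (intro exp_mean_mono cont continuous_on_cball_average nw) (simp add: uq)
    then show "\<exists>N. \<forall>n\<ge>N. exp_mean (f (Suc (s (q n))))
        \<le> exp_mean (\<lambda>y. (f (s (q n)) y + f (s (q n)) (reflect w y)) / 2)"
      by blast
  qed
  then have "w \<in> J" using exp_mean_average_eqD[OF nw g] by (simp add: J_def)
  with wJ show False by simp
qed

text \<open>After some time only recurring directions act, and all of these fix a subsequential
  limit \<open>g\<close>. An upper bound \<open>g + e\<close> reached at one late time of the
  subsequence therefore persists for good.\<close>

theorem uniform_convergence:
  "\<exists>g. uniform_limit B f g sequentially \<and>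
       (\<forall>v y. infinite {i. u i = v} \<longrightarrow> y \<in> B \<longrightarrow> g (reflect v y) = g y)"
proof -
  obtain g k where g: "continuous_on B g" and k: "strict_mono (k :: nat \<Rightarrow> nat)"
    and lim: "uniform_limit B (\<lambda>n. f (k n)) g sequentially"
    using convergent_subsequence[of "\<lambda>n. n"] by blast
  \<comment> \<open>The times whose direction occurs only finitely often form a finite union of
    finite sets, so they end before some \<open>N\<close>.\<close>
  have "{t. finite {i. u i = u t}} \<subseteq> (\<Union>w \<in> {w \<in> range u. finite {i. u i = w}}. {i. u i = w})"
    by auto
  then have "finite {t. finite {i. u i = u t}}"
    by (rule finite_subset) (use finite_directions in auto)
  then obtain N where "\<forall>t\<in>{t. finite {i. u i = u t}}. t < N"
    unfolding finite_nat_set_iff_bounded by (rule exE)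
  then have N: "infinite {i. u i = u t}" if "N \<le> t" for t
    using that by (auto simp: not_less[symmetric])
  have "uniform_limit B (\<lambda>n. f n) g sequentially"
  proof (rule uniform_limit_if_dominated[OF g _ exp_mean_tendsto_limit[OF g k lim]])
    fix e :: real assume "e > 0"
    then obtain m where m: "\<And>n. n \<ge> m \<Longrightarrow> \<forall>y\<in>B. dist (f (k n) y) (g y) < e"
      using uniform_limitD[OF lim] by (auto simp: eventually_sequentially)
    \<comment> \<open>\<open>m' \<ge> m\<close> makes \<open>f (k m')\<close> close to
      \<open>g\<close>, and \<open>k m' \<ge> m' \<ge> N\<close> makes every direction from time
      \<open>k m'\<close> on a recurring one.\<close>
    define m' where "m' = max m N"
    have "N \<le> k m'" using seq_suble[OF k, of m'] by (simp add: m'_def)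
    have "\<forall>y\<in>B. f n y \<le> g y + e" if "k m' \<le> n" for n
    proof (rule upper_bound_persists[OF that])
      fix t y assume "k m' \<le> t" "y \<in> B"
      then show "g (reflect (u t) y) = g y"
        using \<open>N \<le> k m'\<close> by (intro limit_invariant[OF g k lim N]) auto
    next
      show "\<forall>y\<in>B. f (k m') y \<le> g y + e"
        using m[of m'] by (force simp: m'_def dist_real_def abs_less_iff)
    qed
    then show "\<forall>\<^sub>F n in sequentially. \<forall>y\<in>B. f n y \<le> g y + e"
      by (auto simp: eventually_sequentially)
  qed
  with limit_invariant[OF g k lim] show ?thesis by blast
qed

end

section \<open>Convergence in the Hausdorff metric\<close>

lemma compact_convex_steiner_iter:
  assumes "\<And>i. norm (u i) = 1" "compact K" "convex K"
  shows "compact (steiner_iter u K i) \<and> convex (steiner_iter u K i)"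
  by (induction i) (simp_all add: assms compact_steiner convex_steiner)

lemma steiner_iter_nonempty:
  assumes "\<And>i. norm (u i) = 1" "compact K" "convex K" "K \<noteq> {}"
  shows "steiner_iter u K i \<noteq> {}"
  by (induction i) (simp_all add: assms compact_convex_steiner_iter steiner_nonempty)

lemma steiner_iter_subset_cball:
  assumes "\<And>i. norm (u i) = 1" "compact K" "convex K" "K \<subseteq> cball 0 r"
  shows "steiner_iter u K i \<subseteq> cball 0 r"
proof (induction i)
  case (Suc i)
  then show ?case
    using steiner_subset_cball[of "u i" "steiner_iter u K i" r] compact_convex_steiner_iter[of u K i] assms
    by simp
qed (use assms in simp)

section \<open>Hausdorff distance and completeness\<close>

lemma hausdist_le:
  assumes "A \<noteq> {}" "B \<noteq> {}"
    and "\<And>a. a \<in> A \<Longrightarrow> infdist a B \<le> e" "\<And>b. b \<in> B \<Longrightarrow> infdist b A \<le> e"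
  shows "hausdist A B \<le> e"
  unfolding hausdist_def using assms by (simp add: cSUP_least)

text \<open>The bound \<open>e\<close> ensures that the first supremum is over a bounded set;
  otherwise its value would carry no information.\<close>

lemma hausdist_nonneg:
  assumes "A \<noteq> {}" and "\<And>a. a \<in> A \<Longrightarrow> infdist a B \<le> e"
  shows "0 \<le> hausdist A B"
proof -
  obtain a where a: "a \<in> A" using assms by blast
  have "0 \<le> infdist a B" by (rule infdist_nonneg)
  also have "\<dots> \<le> (SUP a\<in>A. infdist a B)"
    by (rule cSUP_upper[OF a bdd_aboveI2[OF assms(2)]])
  finally show ?thesis by (simp add: hausdist_def)
qed

lemma compact_infdist_attained:
  fixes A :: "'a::heine_borel set"
  assumes "compact A" "A \<noteq> {}"
  obtains a where "a \<in> A" "infdist x A = dist x a"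
  using infdist_attains_inf[OF compact_imp_closed[OF assms(1)] assms(2)] by metis

lemma infdist_le_infdist_add:
  fixes A :: "'a::heine_borel set"
  assumes "compact A" "A \<noteq> {}" "\<And>a. a \<in> A \<Longrightarrow> infdist a B \<le> e"
  shows "infdist x B \<le> infdist x A + e"
proof -
  obtain a where "a \<in> A" "infdist x A = dist x a"
    using compact_infdist_attained[OF assms(1,2)] .
  then show ?thesis using infdist_triangle[of x B a] assms(3)[of a] by simp
qed

text \<open>Completeness of the nonempty compact subsets of a compact set. The Cauchy hypothesis is
  symmetric, since \<open>i\<close> and \<open>j\<close> both range over all late indices. In the
  proof, \<open>near\<close> controls the distance from points of \<open>L\<close> to
  \<open>C i\<close>, and \<open>approx\<close> the distance from points of \<open>C i\<close> to
  \<open>L\<close>.\<close>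

lemma hausdorff_cauchy_converges:
  fixes C :: "nat \<Rightarrow> 'a::heine_borel set"
  assumes C: "\<And>i. compact (C i)" "\<And>i. C i \<noteq> {}" and S: "\<And>i. C i \<subseteq> S" "compact S"
    and cauchy: "\<And>e. e > 0 \<Longrightarrow> \<exists>N. \<forall>i\<ge>N. \<forall>j\<ge>N. \<forall>a\<in>C i. infdist a (C j) \<le> e"
  defines "L \<equiv> {x. (\<lambda>i. infdist x (C i)) \<longlonglongrightarrow> 0}"
  shows "compact L" "L \<noteq> {}" "(\<lambda>i. hausdist (C i) L) \<longlonglongrightarrow> 0"
proof -
  have near: "infdist x (C i) \<le> e" if "x \<in> L" "\<forall>j\<ge>N. \<forall>a\<in>C j. infdist a (C i) \<le> e" for x e N i
  proof (rule LIMSEQ_le)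
    show "(\<lambda>j. infdist x (C i)) \<longlonglongrightarrow> infdist x (C i)" by simp
    show "(\<lambda>j. infdist x (C j) + e) \<longlonglongrightarrow> e"
      using \<open>x \<in> L\<close> tendsto_add[of _ 0 sequentially "\<lambda>_. e" e] by (simp add: L_def)
    show "\<exists>N. \<forall>j\<ge>N. infdist x (C i) \<le> infdist x (C j) + e"
      using that(2) infdist_le_infdist_add[OF C] by blast
  qed
  have approx: "\<exists>l\<in>L. dist a l \<le> e"
    if a: "a \<in> C i" and N: "\<forall>i\<ge>N. \<forall>j\<ge>N. \<forall>a\<in>C i. infdist a (C j) \<le> e" and i: "N \<le> i" for a e N i
  proof -
    \<comment> \<open>Points of the sets \<open>C j\<close> nearest to \<open>a\<close> accumulate
      in \<open>S\<close>; the Cauchy property puts the accumulation point in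
      \<open>L\<close>.\<close>
    have "\<exists>b. b \<in> C j \<and> infdist a (C j) = dist a b" for j
      using compact_infdist_attained[OF C] by metis
    then obtain b where b: "\<And>j. b j \<in> C j" "\<And>j. infdist a (C j) = dist a (b j)" by metis
    have "b j \<in> S" for j using b(1)[of j] S(1) by blast
    then obtain l q where q: "strict_mono (q :: nat \<Rightarrow> nat)" and l: "(b \<circ> q) \<longlonglongrightarrow> l"
      using seq_compactE[OF S(2)[unfolded compact_eq_seq_compact_metric]] by blast
    have "l \<in> L"
      unfolding L_def mem_Collect_eq
    proof (rule LIMSEQ_I)
      fix r :: real assume "0 < r"
      then obtain M where M: "\<forall>i\<ge>M. \<forall>j\<ge>M. \<forall>a\<in>C i. infdist a (C j) \<le> r / 3"
        using cauchy[of "r / 3"] by auto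
      obtain n where n: "\<And>k. n \<le> k \<Longrightarrow> dist ((b \<circ> q) k) l < r / 3"
        using metric_LIMSEQ_D[OF l, of "r / 3"] \<open>0 < r\<close> by auto
      define k where "k = max n M"
      have "M \<le> q k" using seq_suble[OF q, of k] by (simp add: k_def)
      have "norm (infdist l (C j) - 0) < r" if "M \<le> j" for j
      proof -
        have "infdist l (C j) \<le> infdist (b (q k)) (C j) + dist l (b (q k))" by (rule infdist_triangle)
        also have "\<dots> \<le> r / 3 + r / 3"
          using M \<open>M \<le> q k\<close> that b(1)[of "q k"] n[of k]
          by (intro add_mono) (auto simp: k_def dist_commute less_imp_le)
        finally show ?thesis using \<open>0 < r\<close> by (simp add: infdist_nonneg)
      qed
      then show "\<exists>no. \<forall>n\<ge>no. norm (infdist l (C n) - 0) < r" by blast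
    qed
    moreover have "dist a l \<le> e"
    proof (rule LIMSEQ_le_const2)
      show "(\<lambda>k. dist a ((b \<circ> q) k)) \<longlonglongrightarrow> dist a l" by (intro tendsto_intros l)
      show "\<exists>M. \<forall>k\<ge>M. dist a ((b \<circ> q) k) \<le> e"
      proof (intro exI allI impI)
        fix k assume "N \<le> k"
        then have "N \<le> q k" using seq_suble[OF q, of k] by simp
        then have "infdist a (C (q k)) \<le> e" using N i a by blast
        then show "dist a ((b \<circ> q) k) \<le> e" using b(2)[of "q k"] by simp
      qed
    qed
    ultimately show ?thesis by blast
  qed
  show neL: "L \<noteq> {}"
  proof -
    obtain N where N: "\<forall>i\<ge>N. \<forall>j\<ge>N. \<forall>a\<in>C i. infdist a (C j) \<le> 1" using cauchy[of 1] by auto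
    obtain a where "a \<in> C N" using C(2) by blast
    then show ?thesis using approx[OF _ N] by blast
  qed
  show "compact L"
  proof -
    have "closed L"
      unfolding closed_sequential_limits
    proof (intro allI impI, elim conjE)
      fix x l assume x: "\<forall>n. x n \<in> L" and xl: "x \<longlonglongrightarrow> l"
      show "l \<in> L"
        unfolding L_def mem_Collect_eq
      proof (rule LIMSEQ_I)
        fix r :: real assume "0 < r"
        then obtain n where n: "dist (x n) l < r / 2"
          using metric_LIMSEQ_D[OF xl, of "r / 2"] by auto
        have "(\<lambda>i. infdist (x n) (C i)) \<longlonglongrightarrow> 0" using x by (simp add: L_def)
        then obtain M where M: "\<And>i. M \<le> i \<Longrightarrow> infdist (x n) (C i) < r / 2"
          using LIMSEQ_D[of _ 0 "r / 2"] \<open>0 < r\<close> by (fastforce simp: infdist_nonneg)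
        have "norm (infdist l (C i) - 0) < r" if "M \<le> i" for i
          using infdist_triangle[of l "C i" "x n"] M[OF that] n by (simp add: dist_commute infdist_nonneg)
        then show "\<exists>no. \<forall>n\<ge>no. norm (infdist l (C n) - 0) < r" by blast
      qed
    qed
    moreover have "L \<subseteq> S"
    proof
      fix x assume "x \<in> L"
      then have "(\<lambda>i. infdist x (C i)) \<longlonglongrightarrow> 0" by (simp add: L_def)
      moreover have "infdist x S \<le> infdist x (C i)" for i by (rule infdist_mono[OF S(1) C(2)])
      ultimately have "infdist x S \<le> 0" by (intro LIMSEQ_le_const) auto
      then have "infdist x S = 0" using infdist_nonneg[of x S] by linarith
      moreover have "S \<noteq> {}" using C(2) S(1) by blast
      ultimately show "x \<in> S" using S(2) in_closed_iff_infdist_zero compact_imp_closed by blast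
    qed
    ultimately show ?thesis using S(2) compact_Int_closed by (metis Int_absorb1)
  qed
  show "(\<lambda>i. hausdist (C i) L) \<longlonglongrightarrow> 0"
  proof (rule LIMSEQ_I)
    fix r :: real assume r: "0 < r"
    then obtain N where N: "\<forall>i\<ge>N. \<forall>j\<ge>N. \<forall>a\<in>C i. infdist a (C j) \<le> r / 2"
      using cauchy[of "r / 2"] by auto
    have "norm (hausdist (C i) L - 0) < r" if i: "N \<le> i" for i
    proof -
      have *: "infdist a L \<le> r / 2" if "a \<in> C i" for a
        using approx[OF that N i] infdist_le2 by blast
      have "infdist x (C i) \<le> r / 2" if "x \<in> L" for x
        using near[OF that, of N i] N i by blast
      then have "hausdist (C i) L \<le> r / 2" using * C neL by (intro hausdist_le) auto
      moreover have "0 \<le> hausdist (C i) L" by (rule hausdist_nonneg[OF C(2) *])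
      ultimately show ?thesis using r by simp
    qed
    then show "\<exists>no. \<forall>n\<ge>no. norm (hausdist (C n) L - 0) < r" by blast
  qed
qed

theorem theorem5p1:
  fixes V :: "'a::euclidean_space set" and u :: "nat \<Rightarrow> 'a" and K :: "'a set"
  assumes "finite V"
    and "\<forall>v\<in>V. norm v = 1"
    and "\<forall>i. u i \<in> V"
    and "compact K" and "convex K" and "K \<noteq> {}"
  shows "\<exists>L. compact L \<and> L \<noteq> {} \<and>
           (\<lambda>i. hausdist (steiner_iter u K i) L) \<longlonglongrightarrow> 0 \<and>
           (\<forall>v\<in>V. infinite {i. u i = v} \<longrightarrow> reflect v ` L = L)"
proof -
  have unit: "norm (u i) = 1" for i using assms by blast
  obtain r where r: "K \<subseteq> cball 0 r"
    using compact_imp_bounded[OF \<open>compact K\<close>] by (auto simp: bounded_any_center[of K 0] subset_eq)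
  define C where "C = steiner_iter u K"
  have C: "compact (C i)" "convex (C i)" "C i \<noteq> {}" "C i \<subseteq> cball 0 r" for i
    unfolding C_def
    using compact_convex_steiner_iter[OF unit assms(4,5)] steiner_iter_nonempty[OF unit assms(4-6)]
      steiner_iter_subset_cball[OF unit assms(4,5) r] by simp_all
  have r0: "0 \<le> r" using C(3,4)[of 0] by (metis cball_eq_empty not_le subset_empty)
  \<comment> \<open>All iterates stay in the ball of radius \<open>r\<close>, which serves both as
    bound on the unit ball and as Lipschitz constant.\<close>
  interpret reflected_averaging u "\<lambda>i. support_fun (C i)" r
  proof
    show "finite (range u)" by (rule finite_subset[OF _ \<open>finite V\<close>]) (use assms in auto)
    show "\<bar>support_fun (C i) y\<bar> \<le> r" if "y \<in> cball 0 1" for i y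
      using abs_support_fun_le[OF C(1,3,4), of i y] mult_left_mono[of "norm y" 1 r] that r0 by simp
    show "support_fun (C (Suc i)) y \<le> (support_fun (C i) y + support_fun (C i) (reflect (u i) y)) / 2" for i y
      using support_fun_steiner_le[OF unit C(1,2,3)] by (simp add: C_def)
  qed (simp_all add: unit support_fun_lipschitz C)
  obtain g where lim: "uniform_limit B (\<lambda>i. support_fun (C i)) g sequentially"
    and inv: "\<forall>v y. infinite {i. u i = v} \<longrightarrow> y \<in> B \<longrightarrow> g (reflect v y) = g y"
    using uniform_convergence by (elim exE conjE)
  have close: "\<exists>N. \<forall>i\<ge>N. \<forall>y\<in>B. \<bar>support_fun (C i) y - g y\<bar> < e" if "e > 0" for e
    using uniform_limitD[OF lim that] by (simp add: eventually_sequentially dist_real_def)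
  \<comment> \<open>Two support functions within \<open>e / 2\<close> of \<open>g\<close> differ by
    less than \<open>e\<close> on the unit ball.\<close>
  have cauchy: "\<exists>N. \<forall>i\<ge>N. \<forall>j\<ge>N. \<forall>a\<in>C i. infdist a (C j) \<le> e" if e: "e > 0" for e
  proof -
    obtain N where N: "\<And>i y. i \<ge> N \<Longrightarrow> y \<in> B \<Longrightarrow> \<bar>support_fun (C i) y - g y\<bar> < e / 2"
      using close[OF half_gt_zero[OF e]] by blast
    have "infdist a (C j) \<le> e" if "N \<le> i" "N \<le> j" "a \<in> C i" for i j a
    proof (rule infdist_le_support_fun)
      fix y :: 'a assume "norm y \<le> 1"
      then have "y \<in> B" by simp
      then show "a \<bullet> y \<le> support_fun (C j) y + e"
        using inner_le_support_fun[OF C(1) \<open>a \<in> C i\<close>, of y] N[OF that(1), of y] N[OF that(2), of y]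
        by linarith
    qed (use C e in auto)
    then show ?thesis by blast
  qed
  \<comment> \<open>The limit set comes from completeness; \<open>g\<close> is not identified as its
    support function, so the symmetry of \<open>L\<close> is drawn from the approximate symmetry of
    the sets \<open>C i\<close>.\<close>
  define L where "L = {x. (\<lambda>i. infdist x (C i)) \<longlonglongrightarrow> 0}"
  have L: "compact L" "L \<noteq> {}" "(\<lambda>i. hausdist (C i) L) \<longlonglongrightarrow> 0"
    unfolding L_def by (rule hausdorff_cauchy_converges[OF C(1,3,4) compact_cball cauchy]; assumption)+
  have refl: "reflect v x \<in> L" if v: "v \<in> V" "infinite {i. u i = v}" and x: "x \<in> L" for v x
    unfolding L_def mem_Collect_eq
  proof (rule LIMSEQ_I)
    fix e :: real assume e: "0 < e"
    have nv: "norm v = 1" using assms v by blast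
    \<comment> \<open>Comparing with \<open>g\<close> at \<open>y\<close> and at
      \<open>reflect v y\<close> costs \<open>e / 4\<close> each, so the reflected nearest point
      lies within \<open>e / 2\<close> of \<open>C i\<close>; the other \<open>e / 2\<close> covers
      the distance from \<open>x\<close> to \<open>C i\<close>.\<close>
    obtain N where N: "\<And>i y. i \<ge> N \<Longrightarrow> y \<in> B \<Longrightarrow> \<bar>support_fun (C i) y - g y\<bar> < e / 4"
      using close[OF divide_pos_pos[OF e zero_less_numeral]] by blast
    have "(\<lambda>i. infdist x (C i)) \<longlonglongrightarrow> 0" using x by (simp add: L_def)
    then obtain M where M: "\<And>i. M \<le> i \<Longrightarrow> infdist x (C i) < e / 2"
      using LIMSEQ_D[of _ 0 "e / 2"] e by (fastforce simp: infdist_nonneg)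
    have less: "infdist (reflect v x) (C i) < e" if i: "max M N \<le> i" for i
    proof -
      obtain a where a: "a \<in> C i" "infdist x (C i) = dist x a"
        using compact_infdist_attained[OF C(1,3)] .
      have "infdist (reflect v a) (C i) \<le> e / 2"
      proof (rule infdist_le_support_fun)
        fix y :: 'a assume y: "norm y \<le> 1"
        then have yB: "y \<in> B" "reflect v y \<in> B" by (simp_all add: norm_reflect nv)
        have "reflect v a \<bullet> y \<le> support_fun (C i) (reflect v y)"
          using inner_le_support_fun[OF C(1) a(1)] by (simp add: inner_reflect)
        moreover have "N \<le> i" using i by simp
        ultimately show "reflect v a \<bullet> y \<le> support_fun (C i) y + e / 2"
          using N[OF _ yB(1), of i] N[OF _ yB(2), of i] inv[rule_format, OF v(2) yB(1)] by linarith
      qed (use C e in auto)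
      moreover have "dist (reflect v x) (reflect v a) = dist x a"
        by (simp add: dist_norm linear_diff[OF linear_reflect, symmetric] norm_reflect nv)
      ultimately show ?thesis
        using infdist_triangle[of "reflect v x" "C i" "reflect v a"] M[of i] i a(2) by simp
    qed
    have "norm (infdist (reflect v x) (C i) - 0) < e" if "max M N \<le> i" for i
      using less[OF that] by (simp add: infdist_nonneg)
    then show "\<exists>no. \<forall>n\<ge>no. norm (infdist (reflect v x) (C n) - 0) < e"
      by (intro exI allI impI)
  qed
  have "reflect v ` L = L" if v: "v \<in> V" "infinite {i. u i = v}" for v
  proof
    show "reflect v ` L \<subseteq> L" using refl[OF v] by blast
    have nv: "norm v = 1" using assms v by blast
    show "L \<subseteq> reflect v ` L"
    proof
      fix x assume "x \<in> L"
      then have "reflect v x \<in> L" by (rule refl[OF v])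
      then show "x \<in> reflect v ` L" by (rule rev_image_eqI) (simp add: reflect_reflect nv)
    qed
  qed
  with L show ?thesis unfolding C_def by blast
qed

end
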